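(* The system $$\frac{dx}{dt}=y+3x,\qquad \frac{dy}{dt}=-xz+x+3y,\qquad \frac{dz}{dt}=xy+6z$$ has $I:=e^{-6t}(x^2-2z)$ as its first integral.
   Context: A first integral is a function of $(x,y,z,t)$ which is constant in $t$ along every solution of the system. *)

theory Defs
  imports "HOL-Analysis.Analysis"
begin

text \<open>
  Solutions of \<open>x' = P(x,y,z)\<close>, \<open>y' = Q(x,y,z)\<close>, \<open>z' = R(x,y,z)\<close> on a time interval \<open>T\<close>.
  The interval may be open, closed, half-open or unbounded; derivatives are one-sided at end points
  belonging to \<open>T\<close>.
\<close>

definition solution_on ::
  "(real \<Rightarrow> real \<Rightarrow> real \<Rightarrow> real) \<Rightarrow> (real \<Rightarrow> real \<Rightarrow> real \<Rightarrow> real) \<Rightarrow> (real \<Rightarrow> real \<Rightarrow> real \<Rightarrow> real) \<Rightarrow>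
   real set \<Rightarrow> (real \<Rightarrow> real) \<Rightarrow> (real \<Rightarrow> real) \<Rightarrow> (real \<Rightarrow> real) \<Rightarrow> bool"
  where "solution_on P Q R T x y z \<longleftrightarrow>
    is_interval T \<and>
    (\<forall>t\<in>T. (x has_real_derivative P (x t) (y t) (z t)) (at t within T) \<and>
           (y has_real_derivative Q (x t) (y t) (z t)) (at t within T) \<and>
           (z has_real_derivative R (x t) (y t) (z t)) (at t within T))"

definition first_integral ::
  "(real \<Rightarrow> real \<Rightarrow> real \<Rightarrow> real) \<Rightarrow> (real \<Rightarrow> real \<Rightarrow> real \<Rightarrow> real) \<Rightarrow> (real \<Rightarrow> real \<Rightarrow> real \<Rightarrow> real) \<Rightarrow>
   (real \<Rightarrow> real \<Rightarrow> real \<Rightarrow> real \<Rightarrow> real) \<Rightarrow> bool"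
  where "first_integral P Q R I \<longleftrightarrow>
    (\<forall>T x y z. solution_on P Q R T x y z \<longrightarrow> (\<lambda>t. I (x t) (y t) (z t) t) constant_on T)"

end

theory Submission
  imports Defs
begin

text \<open>
  Along a solution \<open>(x\<^sup>2 - 2 * z)' = 2 * x * (y + 3 * x) - 2 * (x * y + 6 * z) = 6 * (x\<^sup>2 - 2 * z)\<close>:
  the cross terms \<open>2 * x * y\<close> cancel, and what remains grows exactly at the rate that the factor
  \<open>exp (- 6 * t)\<close> compensates. A function with vanishing derivative on an interval is constant.
\<close>

theorem proposition7p1:
  shows "first_integral
    (\<lambda>x y z. y + 3 * x)
    (\<lambda>x y z. - x * z + x + 3 * y)
    (\<lambda>x y z. x * y + 6 * z)
    (\<lambda>x y z t. exp (- 6 * t) * (x\<^sup>2 - 2 * z))"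
  unfolding first_integral_def
proof (intro allI impI)
  fix T :: "real set" and x y z :: "real \<Rightarrow> real"
  assume sol: "solution_on (\<lambda>x y z. y + 3 * x) (\<lambda>x y z. - x * z + x + 3 * y)
    (\<lambda>x y z. x * y + 6 * z) T x y z"
  let ?I = "\<lambda>t. exp (- 6 * t) * ((x t)\<^sup>2 - 2 * z t)"
  have "convex T"
    using sol by (simp add: solution_on_def is_interval_convex)
  moreover have "(?I has_real_derivative 0) (at t within T)" if "t \<in> T" for t
  proof -
    have [derivative_intros]:
      "(x has_real_derivative y t + 3 * x t) (at t within T)"
      "(z has_real_derivative x t * y t + 6 * z t) (at t within T)"
      using sol that by (auto simp: solution_on_def)
    show ?thesis
      by (auto intro!: derivative_eq_intros simp: algebra_simps power2_eq_square)
  qed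
  ultimately have "\<exists>c. \<forall>t\<in>T. ?I t = c"
    by (metis (no_types, lifting) has_field_derivative_zero_constant)
  then show "?I constant_on T"
    by (simp add: constant_on_def)
qed

end
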